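(* Let $k\in\mathbb N_+$, let $\mathbb V^k$ be $\mathbb P^k$ or $\mathbb Q^k$ (or another suitable subspace of $\mathbb Q^k$), with $\mathbb V^{\lfloor k/2\rfloor}$ the space of the same family, and consider, for a given $\theta\in[-1,1]$, a feasible symmetric CAD with boundary weight $\overline\omega$: $$\langle p\rangle_\Omega=\overline\omega\big[(1+\theta)\langle p\rangle_\Omega^x+(1-\theta)\langle p\rangle_\Omega^y\big]+\sum_{s=1}^S\omega_s\,\overline{p(x^{(s)},y^{(s)})}\qquad\forall p\in\mathbb V^k .$$ If there exists a polynomial $q_\star\in\mathbb V^{\lfloor k/2\rfloor}\setminus\{0\}$ such that $q_\star(x^{(s)},y^{(s)})=0$ for all $s$, then: (a) $\overline\omega_\star(\theta,\mathbb V^k)=\phi^\star(\theta,\mathbb V^k_+)=\phi(q_\star^2;\theta)=\inf_{q\in\mathbb V^{\lfloor k/2\rfloor}}\phi(q^2;\theta)$; (b) this CAD is a symmetric OCAD for $\mathbb V^k$; (c) the polynomial $p^\star:=q_\star^2$ is a critical positive polynomial for $\phi^\star(\theta,\mathbb V^k_+)$.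
   Context: CAD stands for cell average decomposition, OCAD for optimal CAD. $\mathbb P^k$: real polynomials in $(x,y)$ of total degree at most $k$; $\mathbb Q^k$: real polynomials of degree at most $k$ in each variable. $\Omega=[-1,1]^2$, $\langle p\rangle_\Omega=\frac14\iint_\Omega p$, $\langle p\rangle_\Omega^x=\frac14\int_{-1}^1[p(-1,y)+p(1,y)]dy$, $\langle p\rangle_\Omega^y=\frac14\int_{-1}^1[p(x,-1)+p(x,1)]dx$, $\overline{p(a,b)}=\frac14[p(a,b)+p(-a,b)+p(a,-b)+p(-a,-b)]$. A feasible symmetric CAD for $(\theta,\mathbb V^k)$ with boundary weight $\overline\omega$ is an identity of the displayed form, valid for all $p\in\mathbb V^k$, with $S$ finite, $\overline\omega>0$, all $\omega_s>0$ and all $(x^{(s)},y^{(s)})\in[0,1]^2$. $\overline\omega_\star(\theta,\mathbb V^k)$ is the maximum of $\overline\omega$ over all such CADs (for the fixed $\theta$), and a symmetric OCAD is one attaining it. $\mathbb V^k_+=\{p\in\mathbb V^k:p\ge0\text{ on }\Omega\}$. For $p\in\mathbb V^k_+$, $\phi(p;\theta)=\dfrac{\langle p\rangle_\Omega}{(1+\theta)\langle p\rangle_\Omega^x+(1-\theta)\langle p\rangle_\Omega^y}$ if the denominator is nonzero, and $\phi(p;\theta)=+\infty$ otherwise; $\phi^\star(\theta,\mathbb V^k_+)=\inf_{p\in\mathbb V^k_+}\phi(p;\theta)$. A critical positive polynomial for $\phi^\star(\theta,\mathbb V^k_+)$ is a $p^\star\in\mathbb V^k_+\setminus\{0\}$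 with $\phi(p^\star;\theta)=\phi^\star(\theta,\mathbb V^k_+)$.
   Formalization: The polynomial q_⋆ is required to vanish at all four reflected points (±x^(s), ±y^(s)) for every s, not only at (x^(s), y^(s)); with vanishing only at (x^(s), y^(s)) the claim fails, e.g. for P^2, θ=0. *)

theory Defs
  imports "HOL-Analysis.Analysis" "HOL-Computational_Algebra.Polynomial"
begin

text \<open>
  A real polynomial in \<open>(x, y)\<close> is an element of \<open>\<real>[x][y]\<close>: the coefficient of
  \<open>x ^ i * y ^ j\<close> in \<open>p :: real poly poly\<close> is \<open>coeff (coeff p j) i\<close>.
\<close>

definition eval2 :: "real poly poly \<Rightarrow> real \<Rightarrow> real \<Rightarrow> real" where
  "eval2 p x y = poly (poly p [:y:]) x"

definition P_space :: "nat \<Rightarrow> real poly poly set" where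
  "P_space k = {p. \<forall>i j. coeff (coeff p j) i \<noteq> 0 \<longrightarrow> i + j \<le> k}"

definition Q_space :: "nat \<Rightarrow> real poly poly set" where
  "Q_space k = {p. \<forall>i j. coeff (coeff p j) i \<noteq> 0 \<longrightarrow> i \<le> k \<and> j \<le> k}"

text \<open>
  The other admissible families \<open>V\<close>: every \<open>V k\<close> is a real linear subspace of \<open>Q_space k\<close>
  (\<open>smult [:c:]\<close> is multiplication by the real constant \<open>c\<close>), and the squares of the elements
  of \<open>V (k div 2)\<close> lie in \<open>V k\<close>, so that they are legitimate test polynomials for \<open>V k\<close>.
\<close>

definition suitable_family :: "(nat \<Rightarrow> real poly poly set) \<Rightarrow> bool" where
  "suitable_family V \<longleftrightarrow>
     (\<forall>k. module.subspace (\<lambda>c::real. smult [:c:]) (V k) \<and> V k \<subseteq> Q_space k \<and>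
          (\<forall>q\<in>V (k div 2). q\<^sup>2 \<in> V k))"

definition cell_avg :: "real poly poly \<Rightarrow> real" where
  "cell_avg p = 1/4 * integral ({-1..1} \<times> {-1..1}) (\<lambda>(x, y). eval2 p x y)"

definition avg_x :: "real poly poly \<Rightarrow> real" where
  "avg_x p = 1/4 * integral {-1..1} (\<lambda>y. eval2 p (-1) y + eval2 p 1 y)"

definition avg_y :: "real poly poly \<Rightarrow> real" where
  "avg_y p = 1/4 * integral {-1..1} (\<lambda>x. eval2 p x (-1) + eval2 p x 1)"

definition boundary_avg :: "real \<Rightarrow> real poly poly \<Rightarrow> real" where
  "boundary_avg \<theta> p = (1 + \<theta>) * avg_x p + (1 - \<theta>) * avg_y p"

definition sym_avg :: "real poly poly \<Rightarrow> real \<Rightarrow> real \<Rightarrow> real" where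
  "sym_avg p a b = 1/4 * (eval2 p a b + eval2 p (-a) b + eval2 p a (-b) + eval2 p (-a) (-b))"

text \<open>
  The points of the decomposition are those at which \<open>sym_avg\<close> samples \<open>p\<close>, i.e. the
  reflections of the representatives \<open>(a, b) \<in> [0,1]\<^sup>2\<close>. Vanishing of a polynomial on the nodes
  means vanishing at all these points. Vanishing at the representatives alone does not imply
  optimality: for \<open>\<theta> = 0\<close> and \<open>P_space 2\<close>, weight \<open>1/8\<close> with the single representative \<open>(c, c)\<close>,
  \<open>c = sqrt 2 / 3\<close>, of weight \<open>3/4\<close> is feasible and \<open>x - c\<close> vanishes there, but weight \<open>1/4\<close> is
  feasible too (node \<open>(0, 0)\<close> of weight \<open>1/2\<close>).
\<close>

definition sym_nodes :: "real \<Rightarrow> real \<Rightarrow> (real \<times> real) set" where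
  "sym_nodes a b = {(a, b), (-a, b), (a, -b), (-a, -b)}"

text \<open>\<open>S = 0\<close> is allowed: for \<open>P_space 1\<close> the boundary terms alone are exact.\<close>

definition feasible_CAD ::
  "real \<Rightarrow> real poly poly set \<Rightarrow> real \<Rightarrow> nat \<Rightarrow> (nat \<Rightarrow> real) \<Rightarrow> (nat \<Rightarrow> real) \<Rightarrow> (nat \<Rightarrow> real) \<Rightarrow> bool" where
  "feasible_CAD \<theta> W wb S w xs ys \<longleftrightarrow>
     wb > 0 \<and>
     (\<forall>s\<in>{1..S}. w s > 0 \<and> xs s \<in> {0..1} \<and> ys s \<in> {0..1}) \<and>
     (\<forall>p\<in>W. cell_avg p = wb * boundary_avg \<theta> p + (\<Sum>s=1..S. w s * sym_avg p (xs s) (ys s)))"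

definition CAD_weights :: "real \<Rightarrow> real poly poly set \<Rightarrow> real set" where
  "CAD_weights \<theta> W = {wb. \<exists>S w xs ys. feasible_CAD \<theta> W wb S w xs ys}"

definition symmetric_OCAD ::
  "real \<Rightarrow> real poly poly set \<Rightarrow> real \<Rightarrow> nat \<Rightarrow> (nat \<Rightarrow> real) \<Rightarrow> (nat \<Rightarrow> real) \<Rightarrow> (nat \<Rightarrow> real) \<Rightarrow> bool" where
  "symmetric_OCAD \<theta> W wb S w xs ys \<longleftrightarrow>
     feasible_CAD \<theta> W wb S w xs ys \<and> (\<forall>wb'\<in>CAD_weights \<theta> W. wb' \<le> wb)"

text \<open>The maximum weight; it is unspecified unless some \<open>symmetric_OCAD\<close> exists.\<close>

definition omega_star :: "real \<Rightarrow> real poly poly set \<Rightarrow> real" where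
  "omega_star \<theta> W = (GREATEST wb. wb \<in> CAD_weights \<theta> W)"

definition nonneg_part :: "real poly poly set \<Rightarrow> real poly poly set" where
  "nonneg_part W = {p \<in> W. \<forall>x\<in>{-1..1}. \<forall>y\<in>{-1..1}. eval2 p x y \<ge> 0}"

definition phi :: "real \<Rightarrow> real poly poly \<Rightarrow> ereal" where
  "phi \<theta> p = (if boundary_avg \<theta> p \<noteq> 0 then ereal (cell_avg p / boundary_avg \<theta> p) else \<infinity>)"

definition phi_star :: "real \<Rightarrow> real poly poly set \<Rightarrow> ereal" where
  "phi_star \<theta> W = (INF p\<in>nonneg_part W. phi \<theta> p)"

definition critical_positive :: "real \<Rightarrow> real poly poly set \<Rightarrow> real poly poly \<Rightarrow> bool" where
  "critical_positive \<theta> W p \<longleftrightarrow> p \<in> nonneg_part W - {0} \<and> phi \<theta> p = phi_star \<theta> W"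

end

theory Submission
  imports Defs
begin

text \<open>
  The given decomposition bounds \<open>cell_avg p\<close> below by \<open>wb\<close> times the boundary average of \<open>p\<close>
  for every nonnegative \<open>p\<close>, with equality for \<open>q\<^sup>2\<close>, since \<open>q\<^sup>2\<close> vanishes at all nodes; hence
  \<open>wb\<close> is the infimum of \<open>\<phi>\<close>. Testing any other feasible decomposition, of weight \<open>wb'\<close>, on
  \<open>q\<^sup>2\<close>, whose cell average is positive, gives \<open>wb' \<le> wb\<close>.
\<close>

lemma eval2_altdef: "eval2 p x y = (\<Sum>j\<le>degree p. poly (coeff p j) x * y ^ j)"
proof -
  have "poly ([:y:] ^ j) x = y ^ j" for j
    by (simp add: poly_power)
  then show ?thesis
    by (simp add: eval2_def poly_altdef[of p] poly_sum)
qed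

lemma eval2_power: "eval2 (p ^ n) x y = eval2 p x y ^ n"
  by (simp add: eval2_def poly_power)

lemma continuous_on_eval2 [continuous_intros]:
  assumes "continuous_on A f" "continuous_on A g"
  shows "continuous_on A (\<lambda>z. eval2 p (f z) (g z))"
  \<comment> \<open>The definition evaluates at the varying constant polynomial
    \<open>[:y:]\<close>. Expanded in powers of \<open>y\<close>, the value is a finite sum of
    products of continuous real functions, so joint continuity follows termwise.\<close>
  unfolding eval2_altdef by (intro continuous_intros assms)

text \<open>Roots are counted twice. For fixed \<open>y\<close>, the polynomial
  \<open>poly p [:y:]\<close> in \<open>x\<close> has infinitely many roots, so it is zero. Hence
  every constant \<open>[:y:]\<close> with \<open>y\<close> in the interval is a root of
  \<open>p\<close> over the integral domain of polynomials in \<open>x\<close>, and these constants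
  are pairwise distinct.\<close>

lemma eval2_eq_0_on_square_imp:
  assumes "\<And>x y. x \<in> {-1..1} \<Longrightarrow> y \<in> {-1..1} \<Longrightarrow> eval2 p x y = 0"
  shows "p = 0"
proof (rule ccontr)
  assume "p \<noteq> 0"
  have infinite: "infinite {-1..1::real}"
    by simp
  have "poly p [:y:] = 0" if y: "y \<in> {-1..1}" for y
  proof (rule ccontr)
    assume "poly p [:y:] \<noteq> 0"
    then have "finite {x. poly (poly p [:y:]) x = 0}"
      by (rule poly_roots_finite)
    moreover have "{-1..1} \<subseteq> {x. poly (poly p [:y:]) x = 0}"
      using assms y by (auto simp: eval2_def)
    ultimately show False
      using infinite finite_subset by blast
  qed
  then have "(\<lambda>y. [:y:]) ` {-1..1} \<subseteq> {c. poly p c = 0}"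
    by auto
  moreover have "finite {c. poly p c = 0}"
    using \<open>p \<noteq> 0\<close> by (rule poly_roots_finite)
  ultimately have "finite ((\<lambda>y::real. [:y:]) ` {-1..1})"
    by (rule finite_subset)
  then show False
    using infinite finite_imageD[of "\<lambda>y::real. [:y:]" "{-1..1}"] by (simp add: inj_on_def)
qed

text \<open>A nonzero double Cauchy sum has a nonzero term. This splits an exponent pair of the
  product into exponent pairs of the factors, so both notions of degree are handled alike.\<close>

lemma coeff_coeff_mult_nonzeroE:
  fixes p q :: "'a::comm_semiring_0 poly poly"
  assumes "coeff (coeff (p * q) j) i \<noteq> 0"
  obtains a b where "a \<le> i" "b \<le> j"
    "coeff (coeff p b) a \<noteq> 0" "coeff (coeff q (j - b)) (i - a) \<noteq> 0"
proof -
  have "coeff (coeff (p * q) j) i =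
      (\<Sum>b\<le>j. \<Sum>a\<le>i. coeff (coeff p b) a * coeff (coeff q (j - b)) (i - a))"
    by (simp add: coeff_mult coeff_sum)
  with assms obtain b where b: "b \<le> j"
    and nz: "(\<Sum>a\<le>i. coeff (coeff p b) a * coeff (coeff q (j - b)) (i - a)) \<noteq> 0"
    by (metis (no_types, lifting) atMost_iff sum.not_neutral_contains_not_neutral)
  from nz obtain a where "a \<le> i" "coeff (coeff p b) a * coeff (coeff q (j - b)) (i - a) \<noteq> 0"
    by (metis (no_types, lifting) atMost_iff sum.not_neutral_contains_not_neutral)
  with b show ?thesis
    by (intro that[of a b]) auto
qed

lemma P_space_mult:
  assumes "p \<in> P_space m" "q \<in> P_space n"
  shows "p * q \<in> P_space (m + n)"
  unfolding P_space_def
proof (intro CollectI allI impI)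
  fix i j
  assume "coeff (coeff (p * q) j) i \<noteq> 0"
  then obtain a b where ab: "a \<le> i" "b \<le> j"
      "coeff (coeff p b) a \<noteq> 0" "coeff (coeff q (j - b)) (i - a) \<noteq> 0"
    by (rule coeff_coeff_mult_nonzeroE)
  then have "a + b \<le> m" "(i - a) + (j - b) \<le> n"
    using assms unfolding P_space_def by blast+
  with ab show "i + j \<le> m + n"
    by linarith
qed

lemma Q_space_mult:
  assumes "p \<in> Q_space m" "q \<in> Q_space n"
  shows "p * q \<in> Q_space (m + n)"
  unfolding Q_space_def
proof (intro CollectI allI impI)
  fix i j
  assume "coeff (coeff (p * q) j) i \<noteq> 0"
  then obtain a b where ab: "a \<le> i" "b \<le> j"
      "coeff (coeff p b) a \<noteq> 0" "coeff (coeff q (j - b)) (i - a) \<noteq> 0"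
    by (rule coeff_coeff_mult_nonzeroE)
  then have "a \<le> m \<and> b \<le> m" "i - a \<le> n \<and> j - b \<le> n"
    using assms unfolding Q_space_def by blast+
  with ab show "i \<le> m + n \<and> j \<le> m + n"
    by linarith
qed

lemma P_space_mono: "m \<le> n \<Longrightarrow> P_space m \<subseteq> P_space n"
  by (fastforce simp: P_space_def)

lemma Q_space_mono: "m \<le> n \<Longrightarrow> Q_space m \<subseteq> Q_space n"
  by (fastforce simp: Q_space_def)

lemma family_square_mem:
  assumes V: "V = P_space \<or> V = Q_space \<or> suitable_family V"
    and r: "r \<in> V (k div 2)"
  shows "r\<^sup>2 \<in> V k"
proof -
  have le: "k div 2 + k div 2 \<le> k"
    by simp
  from V consider "V = P_space" | "V = Q_space" | "suitable_family V"
    by blast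
  then show ?thesis
  proof cases
    case 1
    with r show ?thesis
      unfolding power2_eq_square using P_space_mult P_space_mono[OF le] by blast
  next
    case 2
    with r show ?thesis
      unfolding power2_eq_square using Q_space_mult Q_space_mono[OF le] by blast
  next
    case 3
    with r show ?thesis
      unfolding suitable_family_def by blast
  qed
qed

lemma family_square_mem_nonneg_part:
  assumes "V = P_space \<or> V = Q_space \<or> suitable_family V" "r \<in> V (k div 2)"
  shows "r\<^sup>2 \<in> nonneg_part (V k)"
  using family_square_mem[OF assms] by (simp add: nonneg_part_def eval2_power)

text \<open>A continuous nonnegative function with zero integral over a box with nonempty interior
  vanishes on the whole box, which would force \<open>q = 0\<close>.\<close>

lemma cell_avg_square_pos:
  assumes "q \<noteq> 0"
  shows "cell_avg (q\<^sup>2) > 0"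
proof -
  define f where "f = (\<lambda>(x, y). eval2 (q\<^sup>2) x y)"
  have sq: "{-1..1} \<times> {-1..1} = cbox (-1, -1) (1::real, 1::real)"
    by (simp add: cbox_Pair_eq)
  have cont: "continuous_on (cbox (-1, -1) (1, 1)) f"
    unfolding f_def case_prod_unfold by (intro continuous_intros)
  have nonneg: "f z \<ge> 0" for z
    by (simp add: f_def case_prod_unfold eval2_power)
  have integrable: "f integrable_on cbox (-1, -1) (1, 1)"
    using cont by (rule integrable_continuous)
  have "integral (cbox (-1, -1) (1, 1)) f \<noteq> 0"
  proof
    assume "integral (cbox (-1, -1) (1, 1)) f = 0"
    with integrable have "(f has_integral 0) (cbox (-1, -1) (1, 1))"
      by (metis integrable_integral)
    moreover have "box (-1, -1) (1::real, 1::real) \<noteq> {}"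
      by (auto simp: box_ne_empty Basis_prod_def)
    ultimately have "f z = 0" if "z \<in> cbox (-1, -1) (1, 1)" for z
      using has_integral_0_cbox_imp_0[OF cont nonneg] that by blast
    then have "eval2 q x y = 0" if "x \<in> {-1..1}" "y \<in> {-1..1}" for x y
      using that by (force simp: f_def eval2_power cbox_Pair_eq)
    with \<open>q \<noteq> 0\<close> show False
      using eval2_eq_0_on_square_imp by blast
  qed
  moreover have "integral (cbox (-1, -1) (1, 1)) f \<ge> 0"
    using integrable nonneg by (simp add: integral_nonneg)
  ultimately show ?thesis
    unfolding cell_avg_def sq f_def by linarith
qed

text \<open>The range of \<theta> makes both factors \<open>1 + \<theta>\<close> and
  \<open>1 - \<theta>\<close> nonnegative.\<close>

lemma boundary_avg_nonneg:
  assumes "\<theta> \<in> {-1..1}" "p \<in> nonneg_part W"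
  shows "boundary_avg \<theta> p \<ge> 0"
proof -
  have nn: "eval2 p x y \<ge> 0" if "x \<in> {-1..1}" "y \<in> {-1..1}" for x y
    using assms(2) that by (auto simp: nonneg_part_def)
  have "integral {-1..1} (\<lambda>y. eval2 p (-1) y + eval2 p 1 y) \<ge> 0"
    by (intro integral_nonneg integrable_continuous_interval continuous_intros add_nonneg_nonneg nn)
      auto
  moreover have "integral {-1..1} (\<lambda>x. eval2 p x (-1) + eval2 p x 1) \<ge> 0"
    by (intro integral_nonneg integrable_continuous_interval continuous_intros add_nonneg_nonneg nn)
      auto
  ultimately show ?thesis
    using assms(1) by (simp add: boundary_avg_def avg_x_def avg_y_def)
qed

text \<open>The node sum is nonnegative: its weights are positive, and all four reflections of a
  node stay in the square. The product form avoids dividing by a boundary average that may be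
  zero.\<close>

lemma feasible_CAD_weight_le:
  assumes "feasible_CAD \<theta> W wb S w xs ys" "p \<in> nonneg_part W"
  shows "wb * boundary_avg \<theta> p \<le> cell_avg p"
proof -
  have "w s * sym_avg p (xs s) (ys s) \<ge> 0" if s: "s \<in> {1..S}" for s
  proof -
    have "w s > 0" "xs s \<in> {0..1}" "ys s \<in> {0..1}"
      using assms(1) s by (auto simp: feasible_CAD_def)
    moreover from this have "sym_avg p (xs s) (ys s) \<ge> 0"
      using assms(2) by (auto simp: sym_avg_def nonneg_part_def intro!: add_nonneg_nonneg)
    ultimately show ?thesis
      by simp
  qed
  then have "(\<Sum>s=1..S. w s * sym_avg p (xs s) (ys s)) \<ge> 0"
    by (rule sum_nonneg)
  moreover have "cell_avg p = wb * boundary_avg \<theta> p + (\<Sum>s=1..S. w s * sym_avg p (xs s) (ys s))"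
    using assms by (auto simp: feasible_CAD_def nonneg_part_def)
  ultimately show ?thesis
    by linarith
qed

lemma feasible_CAD_weight_le_phi:
  assumes "\<theta> \<in> {-1..1}" "feasible_CAD \<theta> W wb S w xs ys" "p \<in> nonneg_part W"
  shows "ereal wb \<le> phi \<theta> p"
  using boundary_avg_nonneg[OF assms(1,3)] feasible_CAD_weight_le[OF assms(2,3)]
  by (auto simp: phi_def field_simps)

theorem theorem3p26:
  fixes V :: "nat \<Rightarrow> real poly poly set"
    and k S :: nat and \<theta> wb :: real
    and w xs ys :: "nat \<Rightarrow> real"
    and q :: "real poly poly"
  assumes "k \<ge> 1"
    and "V = P_space \<or> V = Q_space \<or> suitable_family V"
    and "\<theta> \<in> {-1..1}"
    and "feasible_CAD \<theta> (V k) wb S w xs ys"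
    and "q \<in> V (k div 2) - {0}"
    and "\<forall>s\<in>{1..S}. \<forall>(a, b)\<in>sym_nodes (xs s) (ys s). eval2 q a b = 0"
  shows "(ereal (omega_star \<theta> (V k)) = phi_star \<theta> (V k)
          \<and> phi_star \<theta> (V k) = phi \<theta> (q\<^sup>2)
          \<and> phi \<theta> (q\<^sup>2) = (INF r\<in>V (k div 2). phi \<theta> (r\<^sup>2)))
         \<and> symmetric_OCAD \<theta> (V k) wb S w xs ys
         \<and> critical_positive \<theta> (V k) (q\<^sup>2)"
proof -
  note squares = family_square_mem_nonneg_part[OF assms(2)]
  note lower = feasible_CAD_weight_le_phi[OF assms(3,4)]
  have q: "q \<in> V (k div 2)" "q \<noteq> 0"
    using assms(5) by auto
  have q2: "q\<^sup>2 \<in> nonneg_part (V k)"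
    using q(1) by (rule squares)
  \<comment> \<open>All four sampled values vanish, because \<open>q\<close> is zero at every
    reflection and not only at the representative.\<close>
  have "sym_avg (q\<^sup>2) (xs s) (ys s) = 0" if "s \<in> {1..S}" for s
    using assms(6) that by (simp add: sym_avg_def sym_nodes_def eval2_power)
  then have eq: "cell_avg (q\<^sup>2) = wb * boundary_avg \<theta> (q\<^sup>2)"
    using assms(4) q2 by (auto simp: feasible_CAD_def nonneg_part_def)
  have "wb > 0"
    using assms(4) by (simp add: feasible_CAD_def)
  \<comment> \<open>Positivity of the cell average passes to the boundary average through
    \<open>eq\<close>. So \<open>phi\<close> takes its finite branch at \<open>q\<^sup>2\<close>,
    and the boundary average can be cancelled when weights are compared.\<close>
  with eq cell_avg_square_pos[OF q(2)] have bpos: "boundary_avg \<theta> (q\<^sup>2) > 0"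
    by (simp add: zero_less_mult_iff)
  with eq have phi_q: "phi \<theta> (q\<^sup>2) = ereal wb"
    by (simp add: phi_def)
  have star: "phi_star \<theta> (V k) = ereal wb"
    unfolding phi_star_def using lower q2 phi_q
    by (intro antisym INF_greatest INF_lower2[OF q2]) auto
  \<comment> \<open>Squares are nonnegative test polynomials, so \<open>wb\<close> bounds this
    infimum too, and \<open>r = q\<close> attains it. A zero \<open>r\<close> is harmless, since
    \<open>phi\<close> is then \<infinity>.\<close>
  have inf: "(INF r\<in>V (k div 2). phi \<theta> (r\<^sup>2)) = ereal wb"
    using lower squares phi_q
    by (intro antisym INF_greatest INF_lower2[OF q(1)]) auto
  have max: "wb' \<le> wb" if wb': "wb' \<in> CAD_weights \<theta> (V k)" for wb'
  proof -
    have "wb' * boundary_avg \<theta> (q\<^sup>2) \<le> wb * boundary_avg \<theta> (q\<^sup>2)"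
      using wb' feasible_CAD_weight_le[OF _ q2] eq by (auto simp: CAD_weights_def)
    with bpos show ?thesis
      by simp
  qed
  have "wb \<in> CAD_weights \<theta> (V k)"
    using assms(4) by (auto simp: CAD_weights_def)
  \<comment> \<open>\<open>GREATEST\<close> has a determined value here because \<open>wb\<close> is
    both a feasible weight and an upper bound of all of them.\<close>
  then have "omega_star \<theta> (V k) = wb"
    unfolding omega_star_def using max by (rule Greatest_equality)
  then show ?thesis
    using star inf phi_q max q2 q(2) assms(4)
    by (simp add: symmetric_OCAD_def critical_positive_def)
qed

end
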